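(* Let $\bar u$ be a solution of $$\min_{u\in U_{\mathrm{ad}}}\ \tfrac12\|Ku-z\|_Y^2+\alpha G(u)\qquad (P)$$ with state $\bar y:=K\bar u$. For $\gamma>0$ and $h\ge0$ let $u_{\gamma,h}$ be the solution of $$\min_{u\in U_{\mathrm{ad}}}\ \tfrac12\|K_hu-z\|_Y^2+\alpha G(u)+\tfrac\gamma2\|u\|_{L^2(\Omega)}^2\qquad(P_{\gamma,h})$$ with state $y_{\gamma,h}:=K_hu_{\gamma,h}$. Assume that for all $h>0$ the estimate $$\|(K-K_h)u_{\gamma,h}\|_Y+\|(K^*-K_h^* )(y_{\gamma,h}-z)\|_{L^2(\Omega)}\le\delta(h)$$ holds for all $\gamma>0$, where $\delta:[0,\infty)\to\mathbb{R}$ is a monotonically increasing function (not depending on $\gamma$) with $\delta(0)=0$. If $\bar u$ satisfies Assumption REG with exponent $\kappa>0$, then there is a constant $c>0$ (independent of $\gamma$ and $h$) such that $$\frac1\gamma\|y_{\gamma,h}-\bar y\|_Y^2+\|u_{\gamma,h}-\bar u\|_{L^2(\Omega)}^2\le c\left(\gamma^{-1}(1+\gamma^{-1})\,\delta(h)^2+\gamma^\kappa\right)$$ holds for all $\gamma>0$ and $h\ge0$.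
   Context: Setting: $\Omega\subset\mathbb{R}^n$ is a bounded domain, $Y$ is a (real) Hilbert space, $K:L^2(\Omega)\to Y$ is linear and continuous with adjoint $K^*:Y\to L^2(\Omega)$, $z\in Y$, $\alpha>0$, and $u_1<u_2<\dots<u_d$ are given real numbers, $d\ge2$. Define $g:\mathbb{R}\to\mathbb{R}\cup\{\infty\}$ by $g(v)=\frac12\big((u_i+u_{i+1})v-u_iu_{i+1}\big)$ if $v\in[u_i,u_{i+1}]$, $1\le i<d$, and $g(v)=\infty$ if $v\notin[u_1,u_d]$. Set $G(u)=\int_\Omega g(u(x))\,dx$ for $u\in L^2(\Omega)$, and $U_{\mathrm{ad}}=\{u\in L^2(\Omega): u_1\le u(x)\le u_d \text{ for a.e. } x\in\Omega\}$. For every $h>0$, $K_h:L^2(\Omega)\to Y$ is a linear continuous operator (a discretization of $K$) whose range $Y_h\subset Y$ is finite dimensional; $K_h^*:Y\to L^2(\Omega)$ is its adjoint. For $h=0$ the convention is $K_0:=K$. Assumption REG (for a solution $\bar u$ of $(P)$, with adjoint state $\bar p:=K^*(z-K\bar u)\in L^2(\Omega)$): there exist constants $c>0$ and $\kappa>0$ such that for all sufficiently small $\varepsilon>0$ $$\operatorname{meas}\Big(\bigcup_{i=1}^{d-1}\big\{x\in\Omega:\ |\bar p(x)-\tfrac\alpha2(u_i+u_{i+1})|<\varepsilon\big\}\Big)\le c\,\varepsilon^\kappa,$$ where $\operatorname{meas}$ is Lebesgue measure. *)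

theory Defs
  imports "HOL-Analysis.Analysis"
begin

text \<open>
  The library has no type for \<open>L\<^sup>2\<close> spaces. Elements of \<open>L\<^sup>2(\<Omega>)\<close> are represented by
  square-integrable functions, whose values outside $\Omega$ play no role, and not by their
  classes modulo equality almost everywhere.
\<close>

definition L2 :: "(real ^ 'n) set \<Rightarrow> (real ^ 'n \<Rightarrow> real) set" where
  "L2 \<Omega> = {f \<in> borel_measurable (lebesgue_on \<Omega>). integrable (lebesgue_on \<Omega>) (\<lambda>x. (f x)\<^sup>2)}"

definition L2_inner :: "(real ^ 'n) set \<Rightarrow> (real ^ 'n \<Rightarrow> real) \<Rightarrow> (real ^ 'n \<Rightarrow> real) \<Rightarrow> real" where
  "L2_inner \<Omega> f g = (LINT x|lebesgue_on \<Omega>. f x * g x)"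

definition L2_norm :: "(real ^ 'n) set \<Rightarrow> (real ^ 'n \<Rightarrow> real) \<Rightarrow> real" where
  "L2_norm \<Omega> f = sqrt (L2_inner \<Omega> f f)"

text \<open>
  Continuous linear maps from \<open>L\<^sup>2(\<Omega>)\<close> to Y. The norm bound together with linearity
  forces K to agree on functions that are equal almost everywhere, so that K does act on
  classes.
\<close>

definition L2_bounded_linear ::
    "(real ^ 'n) set \<Rightarrow> ((real ^ 'n \<Rightarrow> real) \<Rightarrow> 'y::real_inner) \<Rightarrow> bool" where
  "L2_bounded_linear \<Omega> K \<longleftrightarrow>
     (\<forall>u\<in>L2 \<Omega>. \<forall>v\<in>L2 \<Omega>. K (\<lambda>x. u x + v x) = K u + K v) \<and>
     (\<forall>r. \<forall>u\<in>L2 \<Omega>. K (\<lambda>x. r * u x) = r *\<^sub>R K u) \<and>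
     (\<exists>C. \<forall>u\<in>L2 \<Omega>. norm (K u) \<le> C * L2_norm \<Omega> u)"

text \<open>
  A relation, since the adjoint is determined only up to the choice of a representative
  of each value.
\<close>

definition L2_adjoint ::
    "(real ^ 'n) set \<Rightarrow> ((real ^ 'n \<Rightarrow> real) \<Rightarrow> 'y::real_inner) \<Rightarrow> ('y \<Rightarrow> real ^ 'n \<Rightarrow> real) \<Rightarrow> bool"
  where
  "L2_adjoint \<Omega> K Ks \<longleftrightarrow>
     (\<forall>y. Ks y \<in> L2 \<Omega>) \<and> (\<forall>u\<in>L2 \<Omega>. \<forall>y. inner (K u) y = L2_inner \<Omega> u (Ks y))"

definition finite_dim_range ::
    "(real ^ 'n) set \<Rightarrow> ((real ^ 'n \<Rightarrow> real) \<Rightarrow> 'y::real_inner) \<Rightarrow> bool" where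
  "finite_dim_range \<Omega> K \<longleftrightarrow> (\<exists>B. finite B \<and> K ` L2 \<Omega> \<subseteq> span B)"

text \<open>
  The values \<open>u\<^sub>1 < \<dots> < u\<^sub>d\<close> are given by a function \<open>a\<close> on the indices 1 to d.
  At a point shared by two intervals both formulas give the same value; lemma \<open>multibang_eq\<close>
  below shows that the choice of the least index is immaterial.
\<close>

definition multibang :: "(nat \<Rightarrow> real) \<Rightarrow> nat \<Rightarrow> real \<Rightarrow> ereal" where
  "multibang a d v =
     (if v \<in> {a 1..a d}
      then let i = (LEAST i. i \<in> {1..<d} \<and> v \<in> {a i..a (Suc i)})
           in ereal (((a i + a (Suc i)) * v - a i * a (Suc i)) / 2)
      else \<infinity>)"

lemma multibang_outside: "v \<notin> {a 1..a d} \<Longrightarrow> multibang a d v = \<infinity>"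
  unfolding multibang_def by (rule if_not_P)

lemma multibang_eq:
  assumes mono: "strict_mono_on {1..d} a"
    and i: "i \<in> {1..<d}" and v: "v \<in> {a i..a (Suc i)}"
  shows "multibang a d v = ereal (((a i + a (Suc i)) * v - a i * a (Suc i)) / 2)"
proof -
  define P where "P = (\<lambda>i. i \<in> {1..<d} \<and> v \<in> {a i..a (Suc i)})"
  define j where "j = (LEAST i. P i)"
  have "P i" using i v unfolding P_def by simp
  then have Pj: "P j" and ji: "j \<le> i" unfolding j_def by (rule LeastI, rule Least_le)
  have le: "a m \<le> a n" if "m \<in> {1..d}" "n \<in> {1..d}" "m \<le> n" for m n
    using that strict_mono_on_leD[OF mono] by blast
  have "a 1 \<le> a i" and "a (Suc i) \<le> a d" using i by (auto intro!: le)
  then have "v \<in> {a 1..a d}" using v by auto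
  then have m: "multibang a d v = ereal (((a j + a (Suc j)) * v - a j * a (Suc j)) / 2)"
    unfolding multibang_def j_def P_def by (simp add: Let_def)
  show ?thesis
  proof (cases "j = i")
    case True
    then show ?thesis using m by simp
  next
    case False
    then have "Suc j \<le> i" using ji by simp
    then have "a (Suc j) \<le> a i" using i by (auto intro!: le)
    moreover have "v \<le> a (Suc j)" using Pj unfolding P_def by simp
    moreover have "a i \<le> v" using v by simp
    ultimately have e: "a (Suc j) = v" "a i = v" by linarith+
    have "(a j + a (Suc j)) * v - a j * a (Suc j) = (a i + a (Suc i)) * v - a i * a (Suc i)"
      unfolding e by (simp add: algebra_simps)
    then show ?thesis using m by simp
  qed
qed

lemma multibang_interval:
  fixes a :: "nat \<Rightarrow> real"
  assumes "d \<ge> 2" and v: "v \<in> {a 1..a d}"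
  obtains i where "i \<in> {1..<d}" "v \<in> {a i..a (Suc i)}"
proof -
  define i where "i = Max {i \<in> {1..<d}. a i \<le> v}"
  have fin: "finite {i \<in> {1..<d}. a i \<le> v}" by simp
  have "1 \<in> {i \<in> {1..<d}. a i \<le> v}" using assms by auto
  then have i: "i \<in> {i \<in> {1..<d}. a i \<le> v}" unfolding i_def using Max_in[OF fin] by blast
  have "v \<le> a (Suc i)"
  proof (rule ccontr)
    assume n: "\<not> v \<le> a (Suc i)"
    with v i have "Suc i \<noteq> d" by auto
    have "a (Suc i) \<le> v" using n by linarith
    with \<open>Suc i \<noteq> d\<close> i have "Suc i \<in> {i \<in> {1..<d}. a i \<le> v}" by auto
    then have "Suc i \<le> i" unfolding i_def using Max_ge[OF fin] by blast
    then show False by simp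
  qed
  then show ?thesis using that i by auto
qed

lemma multibang_ge:
  assumes "d \<ge> 2" and mono: "strict_mono_on {1..d} a"
  shows "multibang a d v \<ge> ereal (v\<^sup>2 / 2)"
proof (cases "v \<in> {a 1..a d}")
  case True
  then obtain i where i: "i \<in> {1..<d}" "v \<in> {a i..a (Suc i)}"
    using multibang_interval assms(1) by blast
  have "0 \<le> (v - a i) * (a (Suc i) - v)" using i by auto
  then show ?thesis
    unfolding multibang_eq[OF mono i] by (simp add: algebra_simps power2_eq_square)
qed (simp add: multibang_outside)

text \<open>
  By \<open>multibang_ge\<close> the integrand is nonnegative, so that \<open>e2ennreal\<close> does not truncate
  it and the extended-valued integral is the nonnegative one.
\<close>

definition multibang_integral ::
    "(real ^ 'n) set \<Rightarrow> (nat \<Rightarrow> real) \<Rightarrow> nat \<Rightarrow> (real ^ 'n \<Rightarrow> real) \<Rightarrow> ereal" where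
  "multibang_integral \<Omega> a d u =
     enn2ereal (\<integral>\<^sup>+x. e2ennreal (multibang a d (u x)) \<partial>lebesgue_on \<Omega>)"

definition U_ad :: "(real ^ 'n) set \<Rightarrow> (nat \<Rightarrow> real) \<Rightarrow> nat \<Rightarrow> (real ^ 'n \<Rightarrow> real) set" where
  "U_ad \<Omega> a d = {u \<in> L2 \<Omega>. AE x in lebesgue_on \<Omega>. a 1 \<le> u x \<and> u x \<le> a d}"

definition objective ::
    "(real ^ 'n) set \<Rightarrow> (nat \<Rightarrow> real) \<Rightarrow> nat \<Rightarrow> real \<Rightarrow> ((real ^ 'n \<Rightarrow> real) \<Rightarrow> 'y::real_inner) \<Rightarrow> 'y
      \<Rightarrow> (real ^ 'n \<Rightarrow> real) \<Rightarrow> ereal" where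
  "objective \<Omega> a d \<alpha> K z u =
     ereal (1 / 2 * (norm (K u - z))\<^sup>2) + ereal \<alpha> * multibang_integral \<Omega> a d u"

definition reg_objective ::
    "(real ^ 'n) set \<Rightarrow> (nat \<Rightarrow> real) \<Rightarrow> nat \<Rightarrow> real \<Rightarrow> real \<Rightarrow> ((real ^ 'n \<Rightarrow> real) \<Rightarrow> 'y::real_inner)
      \<Rightarrow> 'y \<Rightarrow> (real ^ 'n \<Rightarrow> real) \<Rightarrow> ereal" where
  "reg_objective \<Omega> a d \<alpha> \<gamma> K z u =
     objective \<Omega> a d \<alpha> K z u + ereal (\<gamma> / 2 * (L2_norm \<Omega> u)\<^sup>2)"

definition REG ::
    "(real ^ 'n) set \<Rightarrow> (nat \<Rightarrow> real) \<Rightarrow> nat \<Rightarrow> real \<Rightarrow> real \<Rightarrow> (real ^ 'n \<Rightarrow> real) \<Rightarrow> bool" where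
  "REG \<Omega> a d \<alpha> \<kappa> p \<longleftrightarrow> \<kappa> > 0 \<and>
     (\<exists>c>0. \<forall>\<^sub>F \<epsilon> in at_right 0.
        measure lebesgue (\<Union>i\<in>{1..<d}. {x \<in> \<Omega>. \<bar>p x - \<alpha> / 2 * (a i + a (Suc i))\<bar> < \<epsilon>})
          \<le> c * \<epsilon> powr \<kappa>)"

end

theory Submission
  imports Defs
begin

text \<open>
  Outside the set where \<open>p = Ks (z - K ubar)\<close> is within \<open>\<epsilon>\<close> of a threshold, optimality forces \<open>ubar\<close>
  to be a node at which \<open>\<alpha> g v - p v\<close> grows at least like \<open>\<epsilon> \<bar>v - ubar\<bar>\<close>. Adding this growth to the
  variational inequality of the regularized solution \<open>w\<close>, with error \<open>f = w - ubar\<close>, bounds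
  \<open>\<gamma> \<parallel>f\<parallel>\<^sup>2 + \<parallel>T w - K ubar\<parallel>\<^sup>2\<close> by the discretization error and \<open>- \<gamma> (ubar, f)\<close>. For \<open>\<epsilon> = B \<gamma>\<close>, where
  \<open>B\<close> bounds the nodes, the growth absorbs the latter off the exceptional set, whose measure is
  of order \<open>\<gamma> powr \<kappa>\<close>. Young's inequality disposes of the discretization error.
\<close>

subsection \<open>Square-integrable functions\<close>

lemma L2_measurable: "f \<in> L2 \<Omega> \<Longrightarrow> f \<in> borel_measurable (lebesgue_on \<Omega>)"
  by (simp add: L2_def)

lemma L2_integrable_square: "f \<in> L2 \<Omega> \<Longrightarrow> integrable (lebesgue_on \<Omega>) (\<lambda>x. (f x)\<^sup>2)"
  by (simp add: L2_def)

lemma L2_integrable_mult: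
  assumes "f \<in> L2 \<Omega>" "g \<in> L2 \<Omega>"
  shows "integrable (lebesgue_on \<Omega>) (\<lambda>x. f x * g x)"
proof (rule Bochner_Integration.integrable_bound)
  show "integrable (lebesgue_on \<Omega>) (\<lambda>x. (f x)\<^sup>2 + (g x)\<^sup>2)"
    using assms by (intro Bochner_Integration.integrable_add L2_integrable_square)
  show "(\<lambda>x. f x * g x) \<in> borel_measurable (lebesgue_on \<Omega>)"
    using assms[THEN L2_measurable] by measurable
  have "\<bar>s * t\<bar> \<le> \<bar>s\<^sup>2 + t\<^sup>2\<bar>" for s t :: real
  proof -
    have "2 * \<bar>s\<bar> * \<bar>t\<bar> \<le> \<bar>s\<bar>\<^sup>2 + \<bar>t\<bar>\<^sup>2"
      by (rule sum_squares_bound)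
    then have "2 * \<bar>s * t\<bar> \<le> s\<^sup>2 + t\<^sup>2"
      by (simp add: abs_mult)
    then show ?thesis by linarith
  qed
  then show "AE x in lebesgue_on \<Omega>. norm (f x * g x) \<le> norm ((f x)\<^sup>2 + (g x)\<^sup>2)"
    by simp
qed

lemma L2_cmult: "f \<in> L2 \<Omega> \<Longrightarrow> (\<lambda>x. r * f x) \<in> L2 \<Omega>"
  by (auto simp: L2_def power_mult_distrib)

lemma L2_add:
  assumes "f \<in> L2 \<Omega>" "g \<in> L2 \<Omega>"
  shows "(\<lambda>x. f x + g x) \<in> L2 \<Omega>"
proof -
  have "integrable (lebesgue_on \<Omega>) (\<lambda>x. (f x)\<^sup>2 + 2 * (f x * g x) + (g x)\<^sup>2)"
    using assms by (intro Bochner_Integration.integrable_add L2_integrable_square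
        integrable_mult_right L2_integrable_mult)
  moreover have "(\<lambda>x. (f x)\<^sup>2 + 2 * (f x * g x) + (g x)\<^sup>2) = (\<lambda>x. (f x + g x)\<^sup>2)"
    by (auto simp: power2_sum)
  ultimately show ?thesis
    using assms[THEN L2_measurable] by (simp add: L2_def)
qed

lemma L2_diff:
  assumes "f \<in> L2 \<Omega>" "g \<in> L2 \<Omega>"
  shows "(\<lambda>x. f x - g x) \<in> L2 \<Omega>"
  using L2_add[OF assms(1) L2_cmult[OF assms(2), of "- 1"]] by simp

lemma L2_bounded:
  assumes "\<Omega> \<in> lmeasurable" and meas: "f \<in> borel_measurable (lebesgue_on \<Omega>)"
    and "AE x in lebesgue_on \<Omega>. \<bar>f x\<bar> \<le> B"
  shows "f \<in> L2 \<Omega>"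
proof -
  interpret finite_measure "lebesgue_on \<Omega>"
    using assms(1) by (rule finite_measure_lebesgue_on)
  have "integrable (lebesgue_on \<Omega>) (\<lambda>x. (f x)\<^sup>2)"
  proof (rule integrable_const_bound)
    show "AE x in lebesgue_on \<Omega>. norm ((f x)\<^sup>2) \<le> B\<^sup>2"
      using assms(3) by eventually_elim (simp add: abs_le_square_iff[symmetric])
  qed (use meas in measurable)
  then show ?thesis using meas by (simp add: L2_def)
qed

lemma L2_integrable:
  assumes "\<Omega> \<in> lmeasurable" "f \<in> L2 \<Omega>"
  shows "integrable (lebesgue_on \<Omega>) f"
  \<comment> \<open>Since \<open>\<Omega>\<close> has finite measure, the constant 1 is square
    integrable and can serve as the second factor.\<close>
  using L2_integrable_mult[OF assms(2) L2_bounded[OF assms(1), of "\<lambda>_. 1" 1]] by simp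

lemma L2_inner_commute: "L2_inner \<Omega> f g = L2_inner \<Omega> g f"
  by (simp add: L2_inner_def mult.commute)

lemma L2_inner_add_left:
  assumes "f \<in> L2 \<Omega>" "g \<in> L2 \<Omega>" "k \<in> L2 \<Omega>"
  shows "L2_inner \<Omega> (\<lambda>x. f x + g x) k = L2_inner \<Omega> f k + L2_inner \<Omega> g k"
  using assms by (simp add: L2_inner_def distrib_right L2_integrable_mult)

lemma L2_inner_diff_left:
  assumes "f \<in> L2 \<Omega>" "g \<in> L2 \<Omega>" "k \<in> L2 \<Omega>"
  shows "L2_inner \<Omega> (\<lambda>x. f x - g x) k = L2_inner \<Omega> f k - L2_inner \<Omega> g k"
  using assms by (simp add: L2_inner_def left_diff_distrib L2_integrable_mult)

lemma L2_inner_diff_right: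
  assumes "f \<in> L2 \<Omega>" "g \<in> L2 \<Omega>" "k \<in> L2 \<Omega>"
  shows "L2_inner \<Omega> k (\<lambda>x. f x - g x) = L2_inner \<Omega> k f - L2_inner \<Omega> k g"
  using L2_inner_diff_left[OF assms] by (simp add: L2_inner_commute)

lemma L2_inner_cmult_left: "L2_inner \<Omega> (\<lambda>x. r * f x) g = r * L2_inner \<Omega> f g"
  by (simp add: L2_inner_def mult.assoc)

lemma L2_inner_ge_zero: "0 \<le> L2_inner \<Omega> f f"
  by (simp add: L2_inner_def)

lemma L2_norm_square: "(L2_norm \<Omega> f)\<^sup>2 = L2_inner \<Omega> f f"
  by (simp add: L2_norm_def L2_inner_ge_zero)

lemma L2_norm_ge_zero: "0 \<le> L2_norm \<Omega> f"
  by (simp add: L2_norm_def L2_inner_ge_zero)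

text \<open>Expansion in powers of \<open>t\<close>: the linear coefficient supplies the derivative
  of the regularization term, and nonnegativity of the whole expression yields Young's
  inequality.\<close>

lemma L2_norm_square_line:
  assumes "f \<in> L2 \<Omega>" "g \<in> L2 \<Omega>"
  shows "(L2_norm \<Omega> (\<lambda>x. f x + t * g x))\<^sup>2
    = (L2_norm \<Omega> f)\<^sup>2 + 2 * t * L2_inner \<Omega> f g + t\<^sup>2 * (L2_norm \<Omega> g)\<^sup>2"
proof -
  have tg: "(\<lambda>x. t * g x) \<in> L2 \<Omega>" by (rule L2_cmult[OF assms(2)])
  have fg: "(\<lambda>x. f x + t * g x) \<in> L2 \<Omega>" by (rule L2_add[OF assms(1) tg])
  have "L2_inner \<Omega> k (\<lambda>x. f x + t * g x) = L2_inner \<Omega> k f + t * L2_inner \<Omega> k g"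
    if "k \<in> L2 \<Omega>" for k
    using L2_inner_add_left[OF assms(1) tg that]
    by (simp add: L2_inner_commute[of \<Omega> k] L2_inner_cmult_left)
  then have "L2_inner \<Omega> (\<lambda>x. f x + t * g x) (\<lambda>x. f x + t * g x)
    = (L2_inner \<Omega> f f + t * L2_inner \<Omega> f g) + t * (L2_inner \<Omega> g f + t * L2_inner \<Omega> g g)"
    using assms by (simp add: L2_inner_add_left[OF assms(1) tg fg] L2_inner_cmult_left)
  then show ?thesis
    unfolding L2_norm_square
    by (simp add: L2_inner_commute[of \<Omega> g f] algebra_simps power2_eq_square)
qed

text \<open>Expand the square of \<open>g - t * f\<close> and divide by \<open>2 * t\<close>. The
  free weight \<open>t\<close> later lets the term in \<open>f\<close> be absorbed.\<close>

lemma L2_inner_Young: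
  assumes "f \<in> L2 \<Omega>" "g \<in> L2 \<Omega>" "t > 0"
  shows "L2_inner \<Omega> f g \<le> t / 2 * (L2_norm \<Omega> f)\<^sup>2 + 1 / (2 * t) * (L2_norm \<Omega> g)\<^sup>2"
proof -
  have "0 \<le> (L2_norm \<Omega> (\<lambda>x. g x + (- t) * f x))\<^sup>2" by simp
  also have "\<dots> = (L2_norm \<Omega> g)\<^sup>2 - 2 * t * L2_inner \<Omega> f g + t\<^sup>2 * (L2_norm \<Omega> f)\<^sup>2"
    using L2_norm_square_line[OF assms(2,1), of "- t"] by (simp add: L2_inner_commute[of \<Omega> g])
  finally show ?thesis using assms(3) by (simp add: field_simps power2_eq_square)
qed

lemma L2_bounded_linear_line:
  assumes "L2_bounded_linear \<Omega> T" "f \<in> L2 \<Omega>" "g \<in> L2 \<Omega>"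
  shows "T (\<lambda>x. f x + t * g x) = T f + t *\<^sub>R T g"
  using assms L2_cmult[OF assms(3), of t] unfolding L2_bounded_linear_def by simp

lemma L2_bounded_linear_diff:
  assumes "L2_bounded_linear \<Omega> T" "f \<in> L2 \<Omega>" "g \<in> L2 \<Omega>"
  shows "T (\<lambda>x. f x - g x) = T f - T g"
  using L2_bounded_linear_line[OF assms, of "- 1"] by simp

subsection \<open>The multi-bang penalty\<close>

text \<open>
  The piecewise affine interpolant of \<open>v\<^sup>2 / 2\<close> at the nodes is the maximum of its affine pieces,
  because \<open>(v - a i) * (v - a (Suc i))\<close> is negative only between the two nodes. This gives
  convexity and measurability.
\<close>

definition multibang_real :: "(nat \<Rightarrow> real) \<Rightarrow> nat \<Rightarrow> real \<Rightarrow> real" where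
  "multibang_real a d v = Max ((\<lambda>i. ((a i + a (Suc i)) * v - a i * a (Suc i)) / 2) ` {1..<d})"

lemma multibang_real_ge_piece:
  assumes "i \<in> {1..<d}"
  shows "((a i + a (Suc i)) * v - a i * a (Suc i)) / 2 \<le> multibang_real a d v"
  unfolding multibang_real_def using assms by (intro Max_ge) auto

lemma multibang_real_le_iff:
  assumes "d \<ge> 2"
  shows "multibang_real a d v \<le> C
    \<longleftrightarrow> (\<forall>i\<in>{1..<d}. ((a i + a (Suc i)) * v - a i * a (Suc i)) / 2 \<le> C)"
  unfolding multibang_real_def using assms by (subst Max_le_iff) auto

lemma multibang_real_eq:
  assumes mono: "strict_mono_on {1..d} a"
    and i: "i \<in> {1..<d}" and v: "v \<in> {a i..a (Suc i)}"
  shows "multibang_real a d v = ((a i + a (Suc i)) * v - a i * a (Suc i)) / 2"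
proof (rule antisym)
  have le: "a m \<le> a n" if "m \<in> {1..d}" "n \<in> {1..d}" "m \<le> n" for m n
    using that strict_mono_on_leD[OF mono] by blast
  have "((a j + a (Suc j)) * v - a j * a (Suc j)) / 2
      \<le> ((a i + a (Suc i)) * v - a i * a (Suc i)) / 2" if j: "j \<in> {1..<d}" for j
  proof (cases "j = i")
    case False
    \<comment> \<open>Piece \<open>j\<close> equals \<open>v\<^sup>2 / 2\<close> minus half of this
      product. The product is nonnegative for \<open>j\<close> and nonpositive for \<open>i\<close>,
      so \<open>v\<^sup>2 / 2\<close> separates the two pieces.\<close>
    have "0 \<le> (v - a j) * (v - a (Suc j))"
    proof (cases "j < i")
      case True
      then have "a (Suc j) \<le> a i" "a j \<le> a i" using i j by (auto intro!: le)
      then show ?thesis using v by (intro mult_nonneg_nonneg) auto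
    next
      case False
      then have "Suc i \<le> j" using \<open>j \<noteq> i\<close> by simp
      then have "a (Suc i) \<le> a j" "a (Suc i) \<le> a (Suc j)" using i j by (auto intro!: le)
      then show ?thesis using v by (intro mult_nonpos_nonpos) auto
    qed
    moreover have "0 \<le> (v - a i) * (a (Suc i) - v)" using v by auto
    ultimately have "(a j + a (Suc j)) * v - a j * a (Suc j) \<le> (a i + a (Suc i)) * v - a i * a (Suc i)"
      by (simp add: algebra_simps)
    then show ?thesis by (rule divide_right_mono) simp
  qed simp
  then show "multibang_real a d v \<le> ((a i + a (Suc i)) * v - a i * a (Suc i)) / 2"
    using i by (subst multibang_real_le_iff) auto
qed (rule multibang_real_ge_piece[OF i])

lemma multibang_eq_multibang_real:
  assumes "d \<ge> 2" "strict_mono_on {1..d} a" "v \<in> {a 1..a d}"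
  shows "multibang a d v = ereal (multibang_real a d v)"
proof -
  obtain i where "i \<in> {1..<d}" "v \<in> {a i..a (Suc i)}"
    using multibang_interval assms by blast
  then show ?thesis
    using multibang_eq multibang_real_eq assms(2) by metis
qed

lemma multibang_real_node:
  assumes "d \<ge> 2" "strict_mono_on {1..d} a" "k \<in> {1..d}"
  shows "multibang_real a d (a k) = (a k)\<^sup>2 / 2"
proof -
  \<comment> \<open>The last node starts no interval and is treated as the right end of the interval
    with index \<open>d - 1\<close>.\<close>
  define i where "i = (if k = d then k - 1 else k)"
  have i: "i \<in> {1..<d}" and k: "k = i \<or> k = Suc i"
    using assms by (auto simp: i_def)
  have "a i \<le> a (Suc i)" using strict_mono_on_leD[OF assms(2)] i by auto
  then have "a k \<in> {a i..a (Suc i)}" using k by auto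
  from multibang_real_eq[OF assms(2) i this] k show ?thesis
    by (auto simp: algebra_simps power2_eq_square)
qed

lemma multibang_real_nonneg:
  assumes "d \<ge> 2" "strict_mono_on {1..d} a" "v \<in> {a 1..a d}"
  shows "0 \<le> multibang_real a d v"
proof -
  have "0 \<le> v\<^sup>2 / 2" by simp
  also have "v\<^sup>2 / 2 \<le> multibang_real a d v"
    using multibang_ge[of d a v] multibang_eq_multibang_real[OF assms] assms by simp
  finally show ?thesis .
qed

lemma multibang_real_convex:
  assumes "d \<ge> 2" "0 \<le> t" "t \<le> 1"
  shows "multibang_real a d (v + t * (w - v))
    \<le> multibang_real a d v + t * (multibang_real a d w - multibang_real a d v)"
proof (subst multibang_real_le_iff[OF assms(1)], rule ballI)
  fix i assume i: "i \<in> {1..<d}"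
  have "((a i + a (Suc i)) * (v + t * (w - v)) - a i * a (Suc i)) / 2
      = (1 - t) * (((a i + a (Suc i)) * v - a i * a (Suc i)) / 2)
        + t * (((a i + a (Suc i)) * w - a i * a (Suc i)) / 2)"
    by (simp add: field_simps)
  also have "\<dots> \<le> (1 - t) * multibang_real a d v + t * multibang_real a d w"
    using assms by (intro add_mono mult_left_mono multibang_real_ge_piece[OF i]) auto
  finally show "((a i + a (Suc i)) * (v + t * (w - v)) - a i * a (Suc i)) / 2
      \<le> multibang_real a d v + t * (multibang_real a d w - multibang_real a d v)"
    by (simp add: algebra_simps)
qed

text \<open>On an interval an affine function lies between its two end values, so the end values of
  all pieces together bound the maximum. With finite measure this makes the penalty
  integrable.\<close>

lemma multibang_real_abs_le:
  assumes "d \<ge> 2"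
  obtains C where "\<And>v. v \<in> {a 1..a d} \<Longrightarrow> \<bar>multibang_real a d v\<bar> \<le> C"
proof -
  define f where "f i v = ((a i + a (Suc i)) * v - a i * a (Suc i)) / 2" for i v
  define C where "C = (\<Sum>i\<in>{1..<d}. \<bar>f i (a 1)\<bar> + \<bar>f i (a d)\<bar>)"
  have "\<bar>multibang_real a d v\<bar> \<le> C" if v: "v \<in> {a 1..a d}" for v
  proof -
    have "multibang_real a d v \<in> (\<lambda>i. f i v) ` {1..<d}"
      unfolding multibang_real_def f_def using assms by (intro Max_in) auto
    then obtain i where i: "i \<in> {1..<d}" and eq: "multibang_real a d v = f i v" by auto
    have "f i (a 1) \<le> f i v \<and> f i v \<le> f i (a d) \<or> f i (a d) \<le> f i v \<and> f i v \<le> f i (a 1)"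
      unfolding f_def using v mult_left_mono[of "a 1" v "a i + a (Suc i)"]
        mult_left_mono[of v "a d" "a i + a (Suc i)"]
        mult_left_mono_neg[of "a 1" v "a i + a (Suc i)"]
        mult_left_mono_neg[of v "a d" "a i + a (Suc i)"]
      by (cases "0 \<le> a i + a (Suc i)") auto
    then have "\<bar>f i v\<bar> \<le> \<bar>f i (a 1)\<bar> + \<bar>f i (a d)\<bar>" by linarith
    also have "\<dots> \<le> C" unfolding C_def using i by (intro member_le_sum) auto
    finally show ?thesis using eq by simp
  qed
  then show ?thesis by (rule that)
qed

lemma multibang_real_measurable [measurable]: "multibang_real a d \<in> borel_measurable borel"
  unfolding multibang_real_def by measurable

text \<open>
  The subdifferential of the penalty at the node \<open>a k\<close> is the interval between the two adjacent
  slopes; a point of it at distance \<open>\<epsilon>\<close> from its ends yields linear growth with rate \<open>\<epsilon>\<close>.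
\<close>

lemma multibang_real_growth:
  assumes "d \<ge> 2" "strict_mono_on {1..d} a" "\<alpha> > 0" and k: "k \<in> {1..d}"
    and v: "v \<in> {a 1..a d}"
    and upper: "k < d \<Longrightarrow> p + \<epsilon> \<le> \<alpha> / 2 * (a k + a (Suc k))"
    and lower: "k > 1 \<Longrightarrow> \<alpha> / 2 * (a (k - 1) + a k) \<le> p - \<epsilon>"
  shows "\<alpha> * multibang_real a d (a k) - p * a k + \<epsilon> * \<bar>v - a k\<bar>
    \<le> \<alpha> * multibang_real a d v - p * v"
proof -
  \<comment> \<open>An affine piece through the node with slope \<open>s\<close> is a global
    minorant of the penalty. The piece to the right of the node is used for \<open>v > a k\<close>,
    the one to the left for \<open>v < a k\<close>.\<close>
  have growth: "\<alpha> * (a k)\<^sup>2 / 2 + \<alpha> * (s * (v - a k)) \<le> \<alpha> * multibang_real a d v"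
    if "i \<in> {1..<d}" "((a i + a (Suc i)) * v - a i * a (Suc i)) / 2 = (a k)\<^sup>2 / 2 + s * (v - a k)"
    for i s
  proof -
    have "\<alpha> * ((a k)\<^sup>2 / 2 + s * (v - a k)) \<le> \<alpha> * multibang_real a d v"
      using multibang_real_ge_piece[OF that(1), of a v] that(2) assms(3)
      by (intro mult_left_mono) auto
    then show ?thesis by (simp add: algebra_simps)
  qed
  note node = multibang_real_node[OF assms(1,2) k]
  consider "v = a k" | "v > a k" | "v < a k" by linarith
  then show ?thesis
  proof cases
    case 1
    then show ?thesis by simp
  next
    case 2
    then have "k \<noteq> d" using v by auto
    then have kd: "k < d" using k by auto
    have "\<alpha> * (a k)\<^sup>2 / 2 + \<alpha> * ((a k + a (Suc k)) / 2 * (v - a k)) \<le> \<alpha> * multibang_real a d v"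
      using k kd by (intro growth[of k]) (auto simp: field_simps power2_eq_square)
    moreover have "(p + \<epsilon>) * (v - a k) \<le> \<alpha> / 2 * (a k + a (Suc k)) * (v - a k)"
      using upper[OF kd] 2 by (intro mult_right_mono) auto
    moreover have "\<alpha> * ((a k + a (Suc k)) / 2 * (v - a k)) = \<alpha> / 2 * (a k + a (Suc k)) * (v - a k)"
      by simp
    moreover have "(p + \<epsilon>) * (v - a k) = p * v - p * a k + \<epsilon> * \<bar>v - a k\<bar>"
      using 2 by (simp add: algebra_simps)
    ultimately show ?thesis unfolding node by linarith
  next
    case 3
    then have "k \<noteq> 1" using v by auto
    then have k1: "k > 1" using k by auto
    have "\<alpha> * (a k)\<^sup>2 / 2 + \<alpha> * ((a (k - 1) + a k) / 2 * (v - a k)) \<le> \<alpha> * multibang_real a d v"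
      using k k1 by (intro growth[of "k - 1"]) (auto simp: field_simps power2_eq_square)
    moreover have "(p - \<epsilon>) * (v - a k) \<le> \<alpha> / 2 * (a (k - 1) + a k) * (v - a k)"
      using lower[OF k1] 3 by (intro mult_right_mono_neg) auto
    moreover have "\<alpha> * ((a (k - 1) + a k) / 2 * (v - a k)) = \<alpha> / 2 * (a (k - 1) + a k) * (v - a k)"
      by simp
    moreover have "(p - \<epsilon>) * (v - a k) = p * v - p * a k + \<epsilon> * \<bar>v - a k\<bar>"
      using 3 by (simp add: algebra_simps)
    ultimately show ?thesis unfolding node by linarith
  qed
qed

subsection \<open>Minimizers and their variational inequalities\<close>

abbreviation penalty :: "(real ^ 'n) set \<Rightarrow> (nat \<Rightarrow> real) \<Rightarrow> nat \<Rightarrow> (real ^ 'n \<Rightarrow> real) \<Rightarrow> real" where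
  "penalty \<Omega> a d v \<equiv> LINT x|lebesgue_on \<Omega>. multibang_real a d (v x)"

lemma U_ad_L2: "v \<in> U_ad \<Omega> a d \<Longrightarrow> v \<in> L2 \<Omega>"
  by (simp add: U_ad_def)

lemma U_ad_AE: "v \<in> U_ad \<Omega> a d \<Longrightarrow> AE x in lebesgue_on \<Omega>. v x \<in> {a 1..a d}"
  by (simp add: U_ad_def)

lemma U_ad_segment:
  assumes v: "v \<in> U_ad \<Omega> a d" and w: "w \<in> U_ad \<Omega> a d" and t: "0 \<le> t" "t \<le> 1"
  shows "(\<lambda>x. w x + t * (v x - w x)) \<in> U_ad \<Omega> a d"
proof -
  have "(\<lambda>x. w x + t * (v x - w x)) \<in> L2 \<Omega>"
    by (intro L2_add L2_cmult L2_diff U_ad_L2[OF v] U_ad_L2[OF w])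
  moreover have "AE x in lebesgue_on \<Omega>. a 1 \<le> w x + t * (v x - w x) \<and> w x + t * (v x - w x) \<le> a d"
    using U_ad_AE[OF v] U_ad_AE[OF w]
  proof eventually_elim
    case (elim x)
    have "w x + t * (v x - w x) \<in> {a 1..a d}"
      using convexD_alt[OF convex_real_interval(5) elim(2,1) t] by (simp add: algebra_simps)
    then show ?case by simp
  qed
  ultimately show ?thesis by (simp add: U_ad_def)
qed

lemma integrable_multibang_real:
  assumes "\<Omega> \<in> lmeasurable" "d \<ge> 2" and v: "v \<in> U_ad \<Omega> a d"
  shows "integrable (lebesgue_on \<Omega>) (\<lambda>x. multibang_real a d (v x))"
proof -
  interpret finite_measure "lebesgue_on \<Omega>"
    using assms(1) by (rule finite_measure_lebesgue_on)
  have [measurable]: "v \<in> borel_measurable (lebesgue_on \<Omega>)"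
    by (rule L2_measurable[OF U_ad_L2[OF v]])
  obtain C where C: "\<And>v. v \<in> {a 1..a d} \<Longrightarrow> \<bar>multibang_real a d v\<bar> \<le> C"
    using multibang_real_abs_le[OF assms(2), of a] by blast
  show ?thesis
  proof (rule integrable_const_bound)
    show "AE x in lebesgue_on \<Omega>. norm (multibang_real a d (v x)) \<le> C"
      using U_ad_AE[OF v] by eventually_elim (simp only: real_norm_def C)
  qed measurable
qed

text \<open>Almost all values of an admissible function lie in the interval where the penalty is
  finite, nonnegative and bounded. Thus the extended-valued objectives reduce to real ones on
  \<open>U_ad\<close>.\<close>

lemma multibang_integral_eq_penalty:
  assumes "\<Omega> \<in> lmeasurable" "d \<ge> 2" "strict_mono_on {1..d} a" and v: "v \<in> U_ad \<Omega> a d"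
  shows "multibang_integral \<Omega> a d v = ereal (penalty \<Omega> a d v)"
proof -
  have nonneg: "AE x in lebesgue_on \<Omega>. 0 \<le> multibang_real a d (v x)"
    using U_ad_AE[OF v] by eventually_elim (rule multibang_real_nonneg[OF assms(2,3)])
  have "(\<integral>\<^sup>+x. e2ennreal (multibang a d (v x)) \<partial>lebesgue_on \<Omega>)
      = (\<integral>\<^sup>+x. ennreal (multibang_real a d (v x)) \<partial>lebesgue_on \<Omega>)"
  proof (rule nn_integral_cong_AE)
    show "AE x in lebesgue_on \<Omega>. e2ennreal (multibang a d (v x)) = ennreal (multibang_real a d (v x))"
      using U_ad_AE[OF v]
      by eventually_elim (simp add: multibang_eq_multibang_real[OF assms(2,3)] e2ennreal_ereal)
  qed
  also have "\<dots> = ennreal (penalty \<Omega> a d v)"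
    by (intro nn_integral_eq_integral integrable_multibang_real assms nonneg)
  finally have "multibang_integral \<Omega> a d v = enn2ereal (ennreal (penalty \<Omega> a d v))"
    by (simp add: multibang_integral_def)
  moreover have "0 \<le> penalty \<Omega> a d v"
    by (intro integral_nonneg_AE nonneg)
  ultimately show ?thesis by (simp add: enn2ereal_ennreal)
qed

lemma reg_objective_eq:
  assumes "\<Omega> \<in> lmeasurable" "d \<ge> 2" "strict_mono_on {1..d} a" "v \<in> U_ad \<Omega> a d"
  shows "reg_objective \<Omega> a d \<alpha> \<gamma> T z v
    = ereal (1 / 2 * (norm (T v - z))\<^sup>2 + \<alpha> * penalty \<Omega> a d v + \<gamma> / 2 * (L2_norm \<Omega> v)\<^sup>2)"
  by (simp add: reg_objective_def objective_def multibang_integral_eq_penalty[OF assms])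

lemma penalty_segment:
  assumes "\<Omega> \<in> lmeasurable" "d \<ge> 2" and v: "v \<in> U_ad \<Omega> a d" and w: "w \<in> U_ad \<Omega> a d"
    and t: "0 \<le> t" "t \<le> 1"
  shows "penalty \<Omega> a d (\<lambda>x. w x + t * (v x - w x))
    \<le> penalty \<Omega> a d w + t * (penalty \<Omega> a d v - penalty \<Omega> a d w)"
proof -
  note int = integrable_multibang_real[OF assms(1,2)]
  have "penalty \<Omega> a d (\<lambda>x. w x + t * (v x - w x))
      \<le> (LINT x|lebesgue_on \<Omega>. multibang_real a d (w x)
          + t * (multibang_real a d (v x) - multibang_real a d (w x)))"
    using int[OF v] int[OF w]
    by (intro integral_mono int[OF U_ad_segment[OF v w t]] multibang_real_convex assms t) auto
  also have "\<dots> = penalty \<Omega> a d w + t * (penalty \<Omega> a d v - penalty \<Omega> a d w)"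
    using int[OF v] int[OF w] by simp
  finally show ?thesis .
qed

text \<open>Compare \<open>w\<close> with \<open>w + t * (v - w)\<close>: the quadratic terms expand
  exactly, and convexity bounds the penalty by its chord. Dividing by \<open>t\<close> and letting
  \<open>t\<close> tend to 0 leaves the first-order condition. The case \<open>\<gamma> = 0\<close>
  covers the unregularized problem.\<close>

lemma variational_inequality:
  fixes T :: "(real ^ 'n \<Rightarrow> real) \<Rightarrow> 'y::real_inner"
  assumes "\<Omega> \<in> lmeasurable" "d \<ge> 2" "strict_mono_on {1..d} a" "\<alpha> \<ge> 0"
    and T: "L2_bounded_linear \<Omega> T"
    and min: "is_arg_min (reg_objective \<Omega> a d \<alpha> \<gamma> T z) (\<lambda>v. v \<in> U_ad \<Omega> a d) w"
    and v: "v \<in> U_ad \<Omega> a d"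
  shows "inner (T v - T w) (z - T w) - \<gamma> * L2_inner \<Omega> w (\<lambda>x. v x - w x)
    \<le> \<alpha> * (penalty \<Omega> a d v - penalty \<Omega> a d w)"
proof -
  have w: "w \<in> U_ad \<Omega> a d"
    using min by (simp add: is_arg_min_def)
  have least: "reg_objective \<Omega> a d \<alpha> \<gamma> T z w \<le> reg_objective \<Omega> a d \<alpha> \<gamma> T z v'"
    if "v' \<in> U_ad \<Omega> a d" for v'
    using min that by (auto simp: is_arg_min_def not_less[symmetric])
  define e where "e = (\<lambda>x. v x - w x)"
  have e: "e \<in> L2 \<Omega>" unfolding e_def by (intro L2_diff U_ad_L2[OF v] U_ad_L2[OF w])
  have Te: "T e = T v - T w"
    unfolding e_def by (rule L2_bounded_linear_diff[OF T U_ad_L2[OF v] U_ad_L2[OF w]])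
  \<comment> \<open>\<open>L\<close> collects the first-order terms, with the chord slope in place
    of a derivative of the penalty, and \<open>Q\<close> the second-order terms.\<close>
  define L where "L = inner (T w - z) (T e) + \<gamma> * L2_inner \<Omega> w e
    + \<alpha> * (penalty \<Omega> a d v - penalty \<Omega> a d w)"
  define Q where "Q = ((norm (T e))\<^sup>2 + \<gamma> * (L2_norm \<Omega> e)\<^sup>2) / 2"
  have "0 \<le> L + t * Q" if t: "0 < t" "t < 1" for t
  proof -
    have t': "0 \<le> t" "t \<le> 1" using t by auto
    let ?vt = "\<lambda>x. w x + t * e x"
    have vt: "?vt \<in> U_ad \<Omega> a d"
      unfolding e_def by (rule U_ad_segment[OF v w t'])
    have pen: "\<alpha> * penalty \<Omega> a d ?vt
        \<le> \<alpha> * (penalty \<Omega> a d w + t * (penalty \<Omega> a d v - penalty \<Omega> a d w))"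
      using penalty_segment[OF assms(1,2) v w t'] assms(4)
      unfolding e_def by (rule mult_left_mono)
    have eq: "T ?vt - z = (T w - z) + t *\<^sub>R T e"
      by (simp add: L2_bounded_linear_line[OF T U_ad_L2[OF w] e])
    have "(norm (T ?vt - z))\<^sup>2
        = (norm (T w - z))\<^sup>2 + 2 * t * inner (T w - z) (T e) + t\<^sup>2 * (norm (T e))\<^sup>2"
      unfolding eq power2_norm_eq_inner
      by (simp only: inner_add_left inner_add_right inner_scaleR_left inner_scaleR_right)
        (simp add: inner_commute power2_eq_square distrib_left)
    with least[OF vt] pen have "0 \<le> t * (L + t * Q)"
      unfolding reg_objective_eq[OF assms(1-3) vt] reg_objective_eq[OF assms(1-3) w]
        L2_norm_square_line[OF U_ad_L2[OF w] e] L_def Q_def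
      by (simp add: algebra_simps power2_eq_square add_divide_distrib)
    then show ?thesis using t by (simp add: zero_le_mult_iff)
  qed
  then have "\<forall>\<^sub>F t in at_right 0. 0 \<le> L + t * Q"
    unfolding eventually_at_right_field by (intro exI[of _ 1]) auto
  moreover have "((\<lambda>t. L + t * Q) \<longlongrightarrow> L + 0 * Q) (at_right 0)"
    by (intro tendsto_intros)
  ultimately have "0 \<le> L + 0 * Q"
    by (intro tendsto_lowerbound) auto
  moreover have "inner (T v - T w) (z - T w) = - inner (T w - z) (T e)"
    unfolding Te by (simp add: inner_diff_left inner_diff_right inner_commute)
  ultimately show ?thesis by (simp add: L_def e_def)
qed

section \<open>The switching set and linear growth at the unregularized solution\<close>

abbreviation switching_set ::
    "(real ^ 'n) set \<Rightarrow> (nat \<Rightarrow> real) \<Rightarrow> nat \<Rightarrow> real \<Rightarrow> (real ^ 'n \<Rightarrow> real) \<Rightarrow> real \<Rightarrow> (real ^ 'n) set"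
  where
  "switching_set \<Omega> a d \<alpha> p \<epsilon> \<equiv>
     \<Union>i\<in>{1..<d}. {x \<in> \<Omega>. \<bar>p x - \<alpha> / 2 * (a i + a (Suc i))\<bar> < \<epsilon>}"

lemma switching_set_sets:
  assumes "p \<in> borel_measurable (lebesgue_on \<Omega>)"
  shows "switching_set \<Omega> a d \<alpha> p \<epsilon> \<in> sets (lebesgue_on \<Omega>)"
proof -
  have "{x \<in> space (lebesgue_on \<Omega>). \<bar>p x - \<alpha> / 2 * (a i + a (Suc i))\<bar> < \<epsilon>}
      \<in> sets (lebesgue_on \<Omega>)" for i
    using assms by measurable
  then show ?thesis by (intro sets.finite_UN) auto
qed

lemma integrable_indicator_abs_diff:
  assumes "\<Omega> \<in> lmeasurable" "v \<in> L2 \<Omega>" "w \<in> L2 \<Omega>" "A \<in> sets (lebesgue_on \<Omega>)"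
  shows "integrable (lebesgue_on \<Omega>) (\<lambda>x. indicator (- A) x * \<bar>v x - w x\<bar>)"
proof (rule Bochner_Integration.integrable_bound)
  show "integrable (lebesgue_on \<Omega>) (\<lambda>x. v x - w x)"
    by (intro L2_integrable L2_diff assms)
  have [measurable]: "v \<in> borel_measurable (lebesgue_on \<Omega>)" "w \<in> borel_measurable (lebesgue_on \<Omega>)"
    using assms by (auto intro: L2_measurable)
  \<comment> \<open>The complement is taken in the whole space and need not be a subset of
    \<open>\<Omega>\<close>, so its indicator is written as 1 minus that of
    \<open>A\<close>.\<close>
  have [measurable]: "(\<lambda>x. indicator (- A) x :: real) \<in> borel_measurable (lebesgue_on \<Omega>)"
    using borel_measurable_diff[OF borel_measurable_const borel_measurable_indicator[OF assms(4)], of 1]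
    by (simp add: indicator_compl)
  show "(\<lambda>x. indicator (- A) x * \<bar>v x - w x\<bar>) \<in> borel_measurable (lebesgue_on \<Omega>)"
    by measurable
qed (auto split: split_indicator)

text \<open>
  A measurable selection of nodes minimizes the integrand \<open>\<alpha> * g v - p x * v\<close> pointwise, with
  linear growth off the switching set. Comparing the solution with this selection shows that both
  agree there, so that the solution inherits the growth.
\<close>

lemma growth_at_minimizer:
  fixes K :: "(real ^ 'n \<Rightarrow> real) \<Rightarrow> 'y::real_inner"
  assumes lmeas: "\<Omega> \<in> lmeasurable" and d: "d \<ge> 2" and mono: "strict_mono_on {1..d} a"
    and \<alpha>: "\<alpha> > 0" and \<epsilon>: "\<epsilon> > 0"
    and K: "L2_bounded_linear \<Omega> K" and Ks: "L2_adjoint \<Omega> K Ks"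
    and min: "is_arg_min (reg_objective \<Omega> a d \<alpha> 0 K z) (\<lambda>v. v \<in> U_ad \<Omega> a d) ubar"
    and w: "w \<in> U_ad \<Omega> a d"
  defines "A \<equiv> switching_set \<Omega> a d \<alpha> (Ks (z - K ubar)) \<epsilon>"
  shows "inner (K w - K ubar) (z - K ubar)
      + \<epsilon> * (LINT x|lebesgue_on \<Omega>. indicator (- A) x * \<bar>w x - ubar x\<bar>)
    \<le> \<alpha> * (penalty \<Omega> a d w - penalty \<Omega> a d ubar)"
proof -
  have ubar: "ubar \<in> U_ad \<Omega> a d"
    using min by (simp add: is_arg_min_def)
  define p where "p = Ks (z - K ubar)"
  have inner_K: "inner (K v - K ubar) (z - K ubar) = L2_inner \<Omega> v p - L2_inner \<Omega> ubar p"
    if "v \<in> L2 \<Omega>" for v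
    using Ks that U_ad_L2[OF ubar] by (simp add: L2_adjoint_def p_def inner_diff_left)
  have p: "p \<in> L2 \<Omega>" using Ks by (simp add: L2_adjoint_def p_def)
  have [measurable]: "p \<in> borel_measurable (lebesgue_on \<Omega>)" by (rule L2_measurable[OF p])
  have A: "A \<in> sets (lebesgue_on \<Omega>)"
    unfolding A_def p_def[symmetric] by (rule switching_set_sets) measurable
  \<comment> \<open>The first node whose upper threshold exceeds \<open>p x\<close>, or the last
    node if there is none. Minimality of the index gives the lower threshold condition, so
    \<open>p x\<close> lies in \<open>\<alpha>\<close> times the subdifferential at
    \<open>a (k x)\<close>.\<close>
  define k where "k x = (LEAST k. 1 \<le> k \<and> (k = d \<or> p x < \<alpha> / 2 * (a k + a (Suc k))))" for x
  have k: "k x \<in> {1..d}" and k_upper: "k x < d \<Longrightarrow> p x < \<alpha> / 2 * (a (k x) + a (Suc (k x)))" for x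
  proof -
    have ex: "1 \<le> d \<and> (d = d \<or> p x < \<alpha> / 2 * (a d + a (Suc d)))" using d by simp
    have "1 \<le> k x \<and> (k x = d \<or> p x < \<alpha> / 2 * (a (k x) + a (Suc (k x))))"
      unfolding k_def by (rule LeastI[of _ d]) (rule ex)
    moreover have "k x \<le> d" unfolding k_def by (rule Least_le) (rule ex)
    ultimately show "k x \<in> {1..d}" "k x < d \<Longrightarrow> p x < \<alpha> / 2 * (a (k x) + a (Suc (k x)))" by auto
  qed
  have k_lower: "\<alpha> / 2 * (a (k x - 1) + a (k x)) \<le> p x" if "k x > 1" for x
  proof -
    have "k x - 1 < k x" using that by simp
    then have "\<not> (1 \<le> k x - 1 \<and> (k x - 1 = d \<or> p x < \<alpha> / 2 * (a (k x - 1) + a (Suc (k x - 1)))))"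
      by (subst (asm) (2) k_def) (rule not_less_Least)
    then show ?thesis using that by (auto simp: not_less)
  qed
  have "k \<in> measurable (lebesgue_on \<Omega>) (count_space UNIV)"
    unfolding k_def by measurable
  then have uhat_meas: "(\<lambda>x. a (k x)) \<in> borel_measurable (lebesgue_on \<Omega>)"
    by (rule measurable_compose) simp
  have node: "a (k x) \<in> {a 1..a d}" for x
    using k[of x] d by (auto intro!: strict_mono_on_leD[OF mono])
  have uhat: "(\<lambda>x. a (k x)) \<in> U_ad \<Omega> a d"
  proof -
    have "\<bar>a (k x)\<bar> \<le> \<bar>a 1\<bar> + \<bar>a d\<bar>" for x using node[of x] by auto
    then have "(\<lambda>x. a (k x)) \<in> L2 \<Omega>" by (intro L2_bounded[OF lmeas uhat_meas] AE_I2)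
    then show ?thesis using node by (auto simp: U_ad_def)
  qed
  have pointwise: "\<alpha> * multibang_real a d (a (k x)) - a (k x) * p x
        + \<epsilon> * (indicator (- A) x * \<bar>v - a (k x)\<bar>) \<le> \<alpha> * multibang_real a d v - v * p x"
    if v: "v \<in> {a 1..a d}" and x: "x \<in> \<Omega>" for v x
  proof -
    \<comment> \<open>The rate is \<open>\<epsilon>\<close> off the switching set and 0 on it, so
      that one growth estimate serves both cases.\<close>
    define \<epsilon>' where "\<epsilon>' = \<epsilon> * indicator (- A) x"
    have off: "\<epsilon>' \<le> \<bar>p x - \<alpha> / 2 * (a i + a (Suc i))\<bar>" if "i \<in> {1..<d}" for i
      using that x by (auto simp: \<epsilon>'_def A_def p_def not_less split: split_indicator)
    have "\<alpha> * multibang_real a d (a (k x)) - p x * a (k x) + \<epsilon>' * \<bar>v - a (k x)\<bar>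
        \<le> \<alpha> * multibang_real a d v - p x * v"
    proof (rule multibang_real_growth[OF d mono \<alpha> k v])
      assume "k x < d"
      then show "p x + \<epsilon>' \<le> \<alpha> / 2 * (a (k x) + a (Suc (k x)))"
        using off[of "k x"] k_upper[of x] k[of x] by auto
    next
      assume k1: "k x > 1"
      then have "k x - 1 \<in> {1..<d}" "Suc (k x - 1) = k x" using k[of x] by auto
      then show "\<alpha> / 2 * (a (k x - 1) + a (k x)) \<le> p x - \<epsilon>'"
        using off[of "k x - 1"] k_lower[OF k1] by simp
    qed
    then show ?thesis by (simp add: \<epsilon>'_def mult.commute mult.left_commute)
  qed
  \<comment> \<open>\<open>F\<close> is the objective with its tracking term linearized at
    \<open>ubar\<close>, up to a constant. The variational inequality for \<open>ubar\<close> is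
    minimality of \<open>ubar\<close> for \<open>F\<close>.\<close>
  define F where "F v = \<alpha> * penalty \<Omega> a d v - L2_inner \<Omega> v p" for v
  define J where "J v w = (LINT x|lebesgue_on \<Omega>. indicator (- A) x * \<bar>v x - w x\<bar>)"
    for v w :: "real ^ 'n \<Rightarrow> real"
  note int_pen = integrable_multibang_real[OF lmeas d]
  note int_prod = L2_integrable_mult[OF U_ad_L2 p]
  note int_J = integrable_indicator_abs_diff[OF lmeas U_ad_L2 U_ad_L2 A]
  have growth: "F (\<lambda>x. a (k x)) + \<epsilon> * J v (\<lambda>x. a (k x)) \<le> F v" if v: "v \<in> U_ad \<Omega> a d" for v
  proof -
    have "F (\<lambda>x. a (k x)) + \<epsilon> * J v (\<lambda>x. a (k x))
        = (LINT x|lebesgue_on \<Omega>. \<alpha> * multibang_real a d (a (k x)) - a (k x) * p x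
            + \<epsilon> * (indicator (- A) x * \<bar>v x - a (k x)\<bar>))"
      unfolding F_def J_def L2_inner_def
      using int_pen[OF uhat] int_prod[OF uhat] int_J[OF v uhat] by simp
    also have "\<dots> \<le> (LINT x|lebesgue_on \<Omega>. \<alpha> * multibang_real a d (v x) - v x * p x)"
    proof (rule integral_mono_AE)
      show "AE x in lebesgue_on \<Omega>. \<alpha> * multibang_real a d (a (k x)) - a (k x) * p x
          + \<epsilon> * (indicator (- A) x * \<bar>v x - a (k x)\<bar>) \<le> \<alpha> * multibang_real a d (v x) - v x * p x"
        using U_ad_AE[OF v] AE_space
        by eventually_elim (intro pointwise; simp)
    qed (use int_pen[OF uhat] int_prod[OF uhat] int_J[OF v uhat] int_pen[OF v] int_prod[OF v] in auto)
    also have "\<dots> = F v"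
      unfolding F_def L2_inner_def using int_pen[OF v] int_prod[OF v] by simp
    finally show ?thesis .
  qed
  have "F ubar \<le> F (\<lambda>x. a (k x))"
    using variational_inequality[OF lmeas d mono less_imp_le[OF \<alpha>] K min uhat]
    by (simp add: F_def inner_K[OF U_ad_L2[OF uhat]] right_diff_distrib)
  \<comment> \<open>Pass through the node selection: growth at \<open>ubar\<close> together with
    \<open>F ubar \<le> F (\<lambda>x. a (k x))\<close> forces
    \<open>\<epsilon> * J ubar (\<lambda>x. a (k x)) \<le> 0\<close>, so the detour costs
    nothing.\<close>
  moreover have "J w ubar \<le> J w (\<lambda>x. a (k x)) + J ubar (\<lambda>x. a (k x))"
  proof -
    have "J w ubar \<le> (LINT x|lebesgue_on \<Omega>. indicator (- A) x * \<bar>w x - a (k x)\<bar>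
        + indicator (- A) x * \<bar>ubar x - a (k x)\<bar>)"
      unfolding J_def using int_J[OF w uhat] int_J[OF ubar uhat] int_J[OF w ubar]
      by (intro integral_mono) (auto split: split_indicator)
    then show ?thesis
      unfolding J_def using int_J[OF w uhat] int_J[OF ubar uhat] by simp
  qed
  then have "\<epsilon> * J w ubar \<le> \<epsilon> * J w (\<lambda>x. a (k x)) + \<epsilon> * J ubar (\<lambda>x. a (k x))"
    using \<epsilon> by (simp add: distrib_left[symmetric])
  ultimately have "F ubar + \<epsilon> * J w ubar \<le> F w"
    using growth[OF w] growth[OF ubar] by linarith
  then show ?thesis
    by (simp add: F_def J_def inner_K[OF U_ad_L2[OF w]] right_diff_distrib)
qed

subsection \<open>The error estimate\<close>

text \<open>
  The threshold \<open>B * \<gamma>\<close> is chosen such that the growth absorbs the part of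
  \<open>\<gamma> * L2_inner \<Omega> ubar (ubar - w)\<close> off the switching set.
\<close>

lemma error_le_measure_switching_set:
  fixes K T :: "(real ^ 'n \<Rightarrow> real) \<Rightarrow> 'y::real_inner"
  assumes lmeas: "\<Omega> \<in> lmeasurable" and d: "d \<ge> 2" and mono: "strict_mono_on {1..d} a"
    and \<alpha>: "\<alpha> > 0" and \<gamma>: "\<gamma> > 0"
    and B: "B > 0" "\<And>v. v \<in> {a 1..a d} \<Longrightarrow> \<bar>v\<bar> \<le> B"
    and K: "L2_bounded_linear \<Omega> K" "L2_adjoint \<Omega> K Ks"
    and T: "L2_bounded_linear \<Omega> T" "L2_adjoint \<Omega> T Ts"
    and min: "is_arg_min (reg_objective \<Omega> a d \<alpha> 0 K z) (\<lambda>v. v \<in> U_ad \<Omega> a d) ubar"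
    and min_reg: "is_arg_min (reg_objective \<Omega> a d \<alpha> \<gamma> T z) (\<lambda>v. v \<in> U_ad \<Omega> a d) w"
    and state: "norm (K w - T w) \<le> \<delta>"
    and adjoint: "L2_norm \<Omega> (\<lambda>x. Ks (T w - z) x - Ts (T w - z) x) \<le> \<delta>"
  shows "1 / \<gamma> * (norm (T w - K ubar))\<^sup>2 + (L2_norm \<Omega> (\<lambda>x. w x - ubar x))\<^sup>2
    \<le> inverse \<gamma> * (1 + inverse \<gamma>) * \<delta>\<^sup>2
      + 4 * B\<^sup>2 * measure lebesgue (switching_set \<Omega> a d \<alpha> (Ks (z - K ubar)) (B * \<gamma>))"
proof -
  have ubar: "ubar \<in> U_ad \<Omega> a d" and w: "w \<in> U_ad \<Omega> a d"
    using min min_reg by (auto simp: is_arg_min_def)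
  note ubar' = U_ad_L2[OF ubar] and w' = U_ad_L2[OF w]
  interpret finite_measure "lebesgue_on \<Omega>"
    using lmeas by (rule finite_measure_lebesgue_on)
  define A where "A = switching_set \<Omega> a d \<alpha> (Ks (z - K ubar)) (B * \<gamma>)"
  have A: "A \<in> sets (lebesgue_on \<Omega>)"
    unfolding A_def using K(2) by (intro switching_set_sets L2_measurable) (simp add: L2_adjoint_def)
  have A_Int: "A \<inter> \<Omega> = A" by (auto simp: A_def)
  have measure_A: "measure (lebesgue_on \<Omega>) A = measure lebesgue A"
    using lmeas by (intro measure_restrict_space) (auto simp: A_def fmeasurable_def)
  define J where "J = (LINT x|lebesgue_on \<Omega>. indicator (- A) x * \<bar>w x - ubar x\<bar>)"
  define f where "f = (\<lambda>x. w x - ubar x)"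
  define q where "q = (\<lambda>x. Ks (T w - z) x - Ts (T w - z) x)"
  have f: "f \<in> L2 \<Omega>" unfolding f_def by (intro L2_diff ubar' w')
  have Ksy: "Ks (T w - z) \<in> L2 \<Omega>" and Tsy: "Ts (T w - z) \<in> L2 \<Omega>"
    using K(2) T(2) by (auto simp: L2_adjoint_def)
  then have q: "q \<in> L2 \<Omega>" unfolding q_def by (intro L2_diff)
  have Kf: "K f = K w - K ubar" and Tf: "T f = T w - T ubar"
    unfolding f_def by (rule L2_bounded_linear_diff[OF K(1) w' ubar'] L2_bounded_linear_diff[OF T(1) w' ubar'])+
  define N where "N = (L2_norm \<Omega> f)\<^sup>2"
  define Y where "Y = (norm (T w - K ubar))\<^sup>2"
  \<comment> \<open>Each solution is tested against the other. In the sum of the two inequalities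
    the penalties cancel.\<close>
  have "inner (T ubar - T w) (z - T w) - \<gamma> * L2_inner \<Omega> w (\<lambda>x. ubar x - w x)
      \<le> \<alpha> * (penalty \<Omega> a d ubar - penalty \<Omega> a d w)"
    by (rule variational_inequality[OF lmeas d mono less_imp_le[OF \<alpha>] T(1) min_reg ubar])
  moreover have "inner (K w - K ubar) (z - K ubar) + B * \<gamma> * J
      \<le> \<alpha> * (penalty \<Omega> a d w - penalty \<Omega> a d ubar)"
    unfolding J_def A_def using B \<gamma> by (intro growth_at_minimizer[OF lmeas d mono \<alpha> _ K min w]) simp
  moreover have "L2_inner \<Omega> w (\<lambda>x. ubar x - w x) = - L2_inner \<Omega> ubar f - N"
    unfolding N_def f_def L2_norm_square
    by (simp add: L2_inner_diff_right L2_inner_diff_left ubar' w' L2_diff L2_inner_commute[of \<Omega> ubar w])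
  moreover have "inner (T ubar - T w) (z - T w) = inner (T f) (T w - z)"
    by (simp add: Tf inner_diff_left inner_diff_right)
  ultimately have "inner (T f) (T w - z) + inner (K f) (z - K ubar) + B * \<gamma> * J
      + \<gamma> * L2_inner \<Omega> ubar f + \<gamma> * N \<le> 0"
    by (simp add: Kf algebra_simps)
  \<comment> \<open>Pointwise, \<open>\<bar>ubar x\<bar> \<le> B\<close> and
    \<open>\<bar>f x\<bar> \<le> 2 * B\<close>. Off \<open>A\<close> only the first bound is used,
    which produces \<open>B * J\<close>; on \<open>A\<close> both are used.\<close>
  moreover have "- L2_inner \<Omega> ubar f \<le> B * J + 2 * B\<^sup>2 * measure lebesgue A"
  proof -
    have "- L2_inner \<Omega> ubar f = (LINT x|lebesgue_on \<Omega>. - (ubar x * f x))"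
      by (simp add: L2_inner_def)
    also have "\<dots> \<le> (LINT x|lebesgue_on \<Omega>. B * (indicator (- A) x * \<bar>w x - ubar x\<bar>)
        + 2 * B\<^sup>2 * indicator A x)"
    proof (rule integral_mono_AE)
      show "AE x in lebesgue_on \<Omega>. - (ubar x * f x)
          \<le> B * (indicator (- A) x * \<bar>w x - ubar x\<bar>) + 2 * B\<^sup>2 * indicator A x"
        using U_ad_AE[OF ubar] U_ad_AE[OF w]
      proof eventually_elim
        case (elim x)
        have "- (ubar x * f x) \<le> \<bar>ubar x\<bar> * \<bar>f x\<bar>" by (metis abs_ge_minus_self abs_mult)
        also have "\<dots> \<le> B * \<bar>f x\<bar>" using B(2)[OF elim(1)] by (intro mult_right_mono) auto
        finally have le: "- (ubar x * f x) \<le> B * \<bar>f x\<bar>" .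
        have "\<bar>f x\<bar> \<le> 2 * B" unfolding f_def using B(2)[OF elim(1)] B(2)[OF elim(2)] by linarith
        then have "B * \<bar>f x\<bar> \<le> B * (2 * B)" using B(1) by (intro mult_left_mono) auto
        then show ?case using le
          by (auto simp: f_def power2_eq_square split: split_indicator)
      qed
      show "integrable (lebesgue_on \<Omega>) (\<lambda>x. - (ubar x * f x))"
        using L2_integrable_mult[OF ubar' f] by simp
      show "integrable (lebesgue_on \<Omega>) (\<lambda>x. B * (indicator (- A) x * \<bar>w x - ubar x\<bar>)
          + 2 * B\<^sup>2 * indicator A x)"
        using integrable_indicator_abs_diff[OF lmeas w' ubar' A] A
        by (intro Bochner_Integration.integrable_add integrable_mult_right) (auto simp: emeasure_eq_measure)
    qed
    also have "\<dots> = B * J + 2 * B\<^sup>2 * measure lebesgue A"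
      unfolding J_def measure_A[symmetric]
      using integrable_indicator_abs_diff[OF lmeas w' ubar' A] A
      by (simp add: emeasure_eq_measure A_Int)
    finally show ?thesis .
  qed
  then have "\<gamma> * (- L2_inner \<Omega> ubar f) \<le> \<gamma> * (B * J + 2 * B\<^sup>2 * measure lebesgue A)"
    using \<gamma> by (intro mult_left_mono) auto
  \<comment> \<open>Replacing \<open>T f\<close> by \<open>K f\<close> costs exactly the adjoint
    defect \<open>q\<close>. Both pairings then involve \<open>K f\<close>, and the data
    \<open>z\<close> cancel in their sum.\<close>
  moreover have "inner (T f) (T w - z) = inner (K f) (T w - z) - L2_inner \<Omega> f q"
    using K(2) T(2) f Ksy Tsy by (simp add: q_def L2_inner_diff_right L2_adjoint_def)
  moreover have "inner (K f) (T w - z) + inner (K f) (z - K ubar)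
      = Y + inner (K w - T w) (T w - K ubar)"
    unfolding Y_def Kf power2_norm_eq_inner
    by (simp add: inner_diff_left inner_diff_right inner_commute)
  ultimately have est: "\<gamma> * N + Y \<le> 2 * B\<^sup>2 * \<gamma> * measure lebesgue A
      + L2_inner \<Omega> f q - inner (K w - T w) (T w - K ubar)"
    by (simp add: algebra_simps)
  \<comment> \<open>The weight \<open>\<gamma>\<close> lets half of \<open>\<gamma> * N\<close> be
    absorbed on the left. The remainder, after doubling and division by \<open>\<gamma>\<close>, is
    the \<open>\<delta>\<^sup>2 / \<gamma>\<^sup>2\<close> term of the estimate.\<close>
  have "L2_inner \<Omega> f q \<le> \<gamma> / 2 * N + 1 / (2 * \<gamma>) * \<delta>\<^sup>2"
  proof -
    have "(L2_norm \<Omega> q)\<^sup>2 \<le> \<delta>\<^sup>2"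
      using adjoint unfolding q_def by (intro power_mono L2_norm_ge_zero)
    then have "1 / (2 * \<gamma>) * (L2_norm \<Omega> q)\<^sup>2 \<le> 1 / (2 * \<gamma>) * \<delta>\<^sup>2"
      using \<gamma> by (intro mult_left_mono) auto
    then show ?thesis using L2_inner_Young[OF f q \<gamma>] unfolding N_def by linarith
  qed
  moreover have "- inner (K w - T w) (T w - K ubar) \<le> \<delta>\<^sup>2 / 2 + Y / 2"
  proof -
    have "- inner (K w - T w) (T w - K ubar) \<le> norm (K w - T w) * norm (T w - K ubar)"
      using Cauchy_Schwarz_ineq2[of "K w - T w" "T w - K ubar"] by linarith
    also have "\<dots> \<le> \<delta> * norm (T w - K ubar)"
      using state by (intro mult_right_mono) auto
    also have "\<dots> \<le> \<delta>\<^sup>2 / 2 + Y / 2"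
      using sum_squares_bound[of \<delta> "norm (T w - K ubar)"] by (simp add: Y_def)
    finally show ?thesis .
  qed
  ultimately have "\<gamma> * N + Y \<le> 4 * B\<^sup>2 * \<gamma> * measure lebesgue A + \<delta>\<^sup>2 / \<gamma> + \<delta>\<^sup>2"
    using est by (simp add: field_simps)
  then have "(\<gamma> * N + Y) / \<gamma> \<le> (4 * B\<^sup>2 * \<gamma> * measure lebesgue A + \<delta>\<^sup>2 / \<gamma> + \<delta>\<^sup>2) / \<gamma>"
    using \<gamma> by (intro divide_right_mono) auto
  then show ?thesis
    unfolding A_def[symmetric] f_def[symmetric] N_def[symmetric] Y_def[symmetric]
    using \<gamma> by (simp add: field_simps)
qed

text \<open>For large \<open>\<gamma>\<close> the boundedness of the admissible set suffices.\<close>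

lemma error_le_bounded:
  fixes K T :: "(real ^ 'n \<Rightarrow> real) \<Rightarrow> 'y::real_inner"
  assumes lmeas: "\<Omega> \<in> lmeasurable"
    and B: "\<And>v. v \<in> {a 1..a d} \<Longrightarrow> \<bar>v\<bar> \<le> B"
    and K: "L2_bounded_linear \<Omega> K" "\<And>v. v \<in> L2 \<Omega> \<Longrightarrow> norm (K v) \<le> C * L2_norm \<Omega> v"
    and ubar: "ubar \<in> U_ad \<Omega> a d" and w: "w \<in> U_ad \<Omega> a d"
    and state: "norm (K w - T w) \<le> \<delta>" and \<gamma>: "0 < \<gamma>\<^sub>0" "\<gamma>\<^sub>0 \<le> \<gamma>"
  shows "1 / \<gamma> * (norm (T w - K ubar))\<^sup>2 + (L2_norm \<Omega> (\<lambda>x. w x - ubar x))\<^sup>2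
    \<le> 2 * (inverse \<gamma> * (1 + inverse \<gamma>) * \<delta>\<^sup>2)
      + (2 * C\<^sup>2 / \<gamma>\<^sub>0 + 1) * (4 * B\<^sup>2 * measure lebesgue \<Omega>)"
proof -
  interpret finite_measure "lebesgue_on \<Omega>"
    using lmeas by (rule finite_measure_lebesgue_on)
  define f where "f = (\<lambda>x. w x - ubar x)"
  have f: "f \<in> L2 \<Omega>" unfolding f_def by (intro L2_diff U_ad_L2[OF w] U_ad_L2[OF ubar])
  define N where "N = (L2_norm \<Omega> f)\<^sup>2"
  have "N \<le> (LINT x|lebesgue_on \<Omega>. 4 * B\<^sup>2)"
    unfolding N_def L2_norm_square L2_inner_def
  proof (rule integral_mono_AE)
    show "AE x in lebesgue_on \<Omega>. f x * f x \<le> 4 * B\<^sup>2"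
      using U_ad_AE[OF ubar] U_ad_AE[OF w]
    proof eventually_elim
      case (elim x)
      have "\<bar>f x\<bar> \<le> 2 * B" unfolding f_def using B[OF elim(1)] B[OF elim(2)] by linarith
      then have "\<bar>f x\<bar>\<^sup>2 \<le> (2 * B)\<^sup>2" by (intro power_mono) auto
      then show ?case by (simp add: power2_eq_square)
    qed
  qed (use L2_integrable_mult[OF f f] in auto)
  also have "\<dots> = 4 * B\<^sup>2 * measure lebesgue \<Omega>"
    using lmeas by (simp add: measure_restrict_space fmeasurable_def)
  finally have N: "N \<le> 4 * B\<^sup>2 * measure lebesgue \<Omega>" .
  \<comment> \<open>The detour over \<open>K w\<close> brings in only the norm bound
    \<open>C\<close> of \<open>K\<close>; a bound on \<open>T\<close> would depend on
    \<open>h\<close>.\<close>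
  have "norm (T w - K ubar) \<le> norm (T w - K w) + norm (K w - K ubar)"
    using norm_triangle_ineq[of "T w - K w" "K w - K ubar"] by simp
  also have "\<dots> \<le> \<delta> + C * L2_norm \<Omega> f"
    using state K(2)[OF f] L2_bounded_linear_diff[OF K(1) U_ad_L2[OF w] U_ad_L2[OF ubar]]
    by (simp add: f_def norm_minus_commute)
  finally have "(norm (T w - K ubar))\<^sup>2 \<le> (\<delta> + C * L2_norm \<Omega> f)\<^sup>2"
    by (rule power_mono) simp
  also have "\<dots> \<le> 2 * \<delta>\<^sup>2 + 2 * C\<^sup>2 * N"
    using sum_squares_bound[of \<delta> "C * L2_norm \<Omega> f"] by (simp add: N_def power2_sum power_mult_distrib)
  finally have "1 / \<gamma> * (norm (T w - K ubar))\<^sup>2 \<le> 1 / \<gamma> * (2 * \<delta>\<^sup>2 + 2 * C\<^sup>2 * N)"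
    using \<gamma> by (intro mult_left_mono) auto
  also have "\<dots> = 2 * (inverse \<gamma> * \<delta>\<^sup>2) + 2 * C\<^sup>2 / \<gamma> * N"
    by (simp add: divide_inverse distrib_left mult.commute mult.left_commute)
  \<comment> \<open>In the term with \<open>N\<close>, \<open>\<gamma>\<close> is replaced by its
    lower bound \<open>\<gamma>\<^sub>0\<close>; the factor
    \<open>1 + inverse \<gamma> \<ge> 1\<close> is inserted to match the target.\<close>
  also have "\<dots> \<le> 2 * (inverse \<gamma> * (1 + inverse \<gamma>) * \<delta>\<^sup>2) + 2 * C\<^sup>2 / \<gamma>\<^sub>0 * N"
  proof (intro add_mono mult_left_mono mult_right_mono divide_left_mono)
    show "inverse \<gamma> \<le> inverse \<gamma> * (1 + inverse \<gamma>)" using \<gamma> by (simp add: algebra_simps)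
  qed (use \<gamma> in \<open>auto simp: N_def\<close>)
  finally have "1 / \<gamma> * (norm (T w - K ubar))\<^sup>2 + N
      \<le> 2 * (inverse \<gamma> * (1 + inverse \<gamma>) * \<delta>\<^sup>2) + (2 * C\<^sup>2 / \<gamma>\<^sub>0 + 1) * N"
    by (simp add: algebra_simps)
  also have "(2 * C\<^sup>2 / \<gamma>\<^sub>0 + 1) * N \<le> (2 * C\<^sup>2 / \<gamma>\<^sub>0 + 1) * (4 * B\<^sup>2 * measure lebesgue \<Omega>)"
    using \<gamma> by (intro mult_left_mono N) auto
  finally show ?thesis unfolding N_def f_def by simp
qed


section \<open>A constant uniform in \<open>\<gamma>\<close> and \<open>h\<close>\<close>

theorem theorem4p2:
  fixes \<Omega> :: "(real ^ 'n) set"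
    and K :: "(real ^ 'n \<Rightarrow> real) \<Rightarrow> 'y::{real_inner, complete_space}"
    and Ks :: "'y \<Rightarrow> real ^ 'n \<Rightarrow> real"
    and Kh :: "real \<Rightarrow> (real ^ 'n \<Rightarrow> real) \<Rightarrow> 'y"
    and Khs :: "real \<Rightarrow> 'y \<Rightarrow> real ^ 'n \<Rightarrow> real"
    and z :: 'y
    and \<alpha> \<kappa> :: real
    and a :: "nat \<Rightarrow> real" and d :: nat
    and ubar :: "real ^ 'n \<Rightarrow> real"
    and u :: "real \<Rightarrow> real \<Rightarrow> real ^ 'n \<Rightarrow> real"
    and \<delta> :: "real \<Rightarrow> real"
  assumes "open \<Omega>" and "connected \<Omega>" and "bounded \<Omega>" and "\<Omega> \<noteq> {}"
    and "d \<ge> 2" and "strict_mono_on {1..d} a"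
    and "\<alpha> > 0"
    and "L2_bounded_linear \<Omega> K" and "L2_adjoint \<Omega> K Ks"
    and "\<And>h. h > 0 \<Longrightarrow> L2_bounded_linear \<Omega> (Kh h)"
    and "\<And>h. h > 0 \<Longrightarrow> finite_dim_range \<Omega> (Kh h)"
    and "\<And>h. h > 0 \<Longrightarrow> L2_adjoint \<Omega> (Kh h) (Khs h)"
    and "Kh 0 = K"
    and "is_arg_min (objective \<Omega> a d \<alpha> K z) (\<lambda>v. v \<in> U_ad \<Omega> a d) ubar"
    and "\<And>\<gamma> h. \<gamma> > 0 \<Longrightarrow> h \<ge> 0 \<Longrightarrow>
           is_arg_min (reg_objective \<Omega> a d \<alpha> \<gamma> (Kh h) z) (\<lambda>v. v \<in> U_ad \<Omega> a d) (u \<gamma> h)"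
    and "mono_on {0..} \<delta>" and "\<delta> 0 = 0"
    and "\<And>\<gamma> h. \<gamma> > 0 \<Longrightarrow> h > 0 \<Longrightarrow>
           norm (K (u \<gamma> h) - Kh h (u \<gamma> h))
           + L2_norm \<Omega> (\<lambda>x. Ks (Kh h (u \<gamma> h) - z) x - Khs h (Kh h (u \<gamma> h) - z) x) \<le> \<delta> h"
    and "REG \<Omega> a d \<alpha> \<kappa> (Ks (z - K ubar))"
  shows "\<exists>c>0. \<forall>\<gamma>>0. \<forall>h\<ge>0.
           1 / \<gamma> * (norm (Kh h (u \<gamma> h) - K ubar))\<^sup>2 + (L2_norm \<Omega> (\<lambda>x. u \<gamma> h x - ubar x))\<^sup>2
             \<le> c * (inverse \<gamma> * (1 + inverse \<gamma>) * (\<delta> h)\<^sup>2 + \<gamma> powr \<kappa>)"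
proof -
  have lmeas: "\<Omega> \<in> lmeasurable"
    using assms(1,3) by (intro lmeasurable_open)
  note d = assms(5) and mono = assms(6) and \<alpha> = assms(7) and K = assms(8,9)
  \<comment> \<open>\<open>Khs\<close> is an adjoint only for positive \<open>h\<close>; at
    \<open>h = 0\<close> the operator is \<open>K\<close> and its adjoint \<open>Ks\<close> takes
    over.\<close>
  define Ts where "Ts h = (if h = 0 then Ks else Khs h)" for h
  have T: "L2_bounded_linear \<Omega> (Kh h)" "L2_adjoint \<Omega> (Kh h) (Ts h)" if "h \<ge> 0" for h
    using that assms(10,12,13) K by (cases "h = 0"; simp add: Ts_def)+
  have min: "is_arg_min (reg_objective \<Omega> a d \<alpha> 0 K z) (\<lambda>v. v \<in> U_ad \<Omega> a d) ubar"
    using assms(14) by (simp add: is_arg_min_def reg_objective_def flip: zero_ereal_def)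
  have ubar: "ubar \<in> U_ad \<Omega> a d" and u: "\<gamma> > 0 \<Longrightarrow> h \<ge> 0 \<Longrightarrow> u \<gamma> h \<in> U_ad \<Omega> a d" for \<gamma> h
    using min assms(15)[of \<gamma> h] by (auto simp: is_arg_min_def)
  have \<delta>: "norm (K (u \<gamma> h) - Kh h (u \<gamma> h)) \<le> \<delta> h"
    "L2_norm \<Omega> (\<lambda>x. Ks (Kh h (u \<gamma> h) - z) x - Ts h (Kh h (u \<gamma> h) - z) x) \<le> \<delta> h"
    if "\<gamma> > 0" "h \<ge> 0" for \<gamma> h
  proof -
    have "norm (K (u \<gamma> h) - Kh h (u \<gamma> h))
        + L2_norm \<Omega> (\<lambda>x. Ks (Kh h (u \<gamma> h) - z) x - Ts h (Kh h (u \<gamma> h) - z) x) \<le> \<delta> h"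
    \<comment> \<open>At \<open>h = 0\<close> both differences vanish and
      \<open>\<delta> 0 = 0\<close>, so the consistency estimate extends to all
      \<open>h \<ge> 0\<close>.\<close>
    proof (cases "h = 0")
      case True
      then show ?thesis
        by (simp add: Ts_def assms(13,17) L2_norm_def L2_inner_def)
    qed (use assms(18)[OF that(1)] that in \<open>simp add: Ts_def\<close>)
    moreover note norm_ge_zero[of "K (u \<gamma> h) - Kh h (u \<gamma> h)"]
      L2_norm_ge_zero[of \<Omega> "\<lambda>x. Ks (Kh h (u \<gamma> h) - z) x - Ts h (Kh h (u \<gamma> h) - z) x"]
    ultimately show "norm (K (u \<gamma> h) - Kh h (u \<gamma> h)) \<le> \<delta> h"
      "L2_norm \<Omega> (\<lambda>x. Ks (Kh h (u \<gamma> h) - z) x - Ts h (Kh h (u \<gamma> h) - z) x) \<le> \<delta> h"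
      by linarith+
  qed
  define B where "B = \<bar>a 1\<bar> + \<bar>a d\<bar>"
  have "a 1 < a d" using d by (intro strict_mono_onD[OF mono]) auto
  then have B: "B > 0" unfolding B_def by linarith
  have bound: "\<bar>v\<bar> \<le> B" if "v \<in> {a 1..a d}" for v using that unfolding B_def by auto
  obtain C where C: "\<And>v. v \<in> L2 \<Omega> \<Longrightarrow> norm (K v) \<le> C * L2_norm \<Omega> v"
    using K(1) unfolding L2_bounded_linear_def by blast
  obtain c\<^sub>0 \<epsilon>\<^sub>0 where \<kappa>: "\<kappa> > 0" and c0: "c\<^sub>0 > 0" and \<epsilon>0: "\<epsilon>\<^sub>0 > 0"
    and reg: "\<And>\<epsilon>. 0 < \<epsilon> \<Longrightarrow> \<epsilon> < \<epsilon>\<^sub>0 \<Longrightarrow>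
      measure lebesgue (switching_set \<Omega> a d \<alpha> (Ks (z - K ubar)) \<epsilon>) \<le> c\<^sub>0 * \<epsilon> powr \<kappa>"
    using assms(19) unfolding REG_def eventually_at_right_field by blast
  \<comment> \<open>Below \<open>\<gamma>\<^sub>0\<close> the threshold \<open>B * \<gamma>\<close>
    stays under \<open>\<epsilon>\<^sub>0\<close>, which is the range where the measure bound of
    \<open>REG\<close> holds.\<close>
  define \<gamma>\<^sub>0 where "\<gamma>\<^sub>0 = \<epsilon>\<^sub>0 / B"
  have \<gamma>0: "\<gamma>\<^sub>0 > 0" using \<epsilon>0 B by (simp add: \<gamma>\<^sub>0_def)
  define c\<^sub>1 where "c\<^sub>1 = 4 * B\<^sup>2 * (c\<^sub>0 * B powr \<kappa>)"
  define E where "E = (2 * C\<^sup>2 / \<gamma>\<^sub>0 + 1) * (4 * B\<^sup>2 * measure lebesgue \<Omega>)"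
  \<comment> \<open>The 2 is the factor of the discretization error for large
    \<open>\<gamma>\<close>, \<open>c\<^sub>1\<close> comes from the measure bound for small
    \<open>\<gamma>\<close>, and the last term turns the constant \<open>E\<close> into a multiple
    of \<open>\<gamma> powr \<kappa>\<close> for
    \<open>\<gamma> \<ge> \<gamma>\<^sub>0\<close>.\<close>
  define c where "c = 2 + c\<^sub>1 + E / \<gamma>\<^sub>0 powr \<kappa>"
  have c1: "c\<^sub>1 \<ge> 0" and E: "E \<ge> 0"
    using c0 \<gamma>0 by (auto simp: c\<^sub>1_def E_def)
  have E': "E / \<gamma>\<^sub>0 powr \<kappa> \<ge> 0" using E by simp
  have "c > 0" unfolding c_def using c1 E' by linarith
  moreover have "1 / \<gamma> * (norm (Kh h (u \<gamma> h) - K ubar))\<^sup>2 + (L2_norm \<Omega> (\<lambda>x. u \<gamma> h x - ubar x))\<^sup>2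
      \<le> c * (inverse \<gamma> * (1 + inverse \<gamma>) * (\<delta> h)\<^sup>2 + \<gamma> powr \<kappa>)" (is "?lhs \<le> _")
    if \<gamma>: "\<gamma> > 0" and h: "h \<ge> 0" for \<gamma> h
  proof -
    define D where "D = inverse \<gamma> * (1 + inverse \<gamma>) * (\<delta> h)\<^sup>2"
    have D: "D \<ge> 0" using \<gamma> by (simp add: D_def)
    have "?lhs \<le> 2 * D + (c\<^sub>1 + E / \<gamma>\<^sub>0 powr \<kappa>) * \<gamma> powr \<kappa>"
    proof (cases "\<gamma> < \<gamma>\<^sub>0")
      case True
      then have "B * \<gamma> < \<epsilon>\<^sub>0" using B by (simp add: \<gamma>\<^sub>0_def field_simps)
      then have "measure lebesgue (switching_set \<Omega> a d \<alpha> (Ks (z - K ubar)) (B * \<gamma>))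
          \<le> c\<^sub>0 * (B * \<gamma>) powr \<kappa>"
        using B \<gamma> by (intro reg) auto
      then have "4 * B\<^sup>2 * measure lebesgue (switching_set \<Omega> a d \<alpha> (Ks (z - K ubar)) (B * \<gamma>))
          \<le> 4 * B\<^sup>2 * (c\<^sub>0 * (B * \<gamma>) powr \<kappa>)"
        by (rule mult_left_mono) simp
      also have "\<dots> = c\<^sub>1 * \<gamma> powr \<kappa>"
        using B \<gamma> by (simp add: c\<^sub>1_def powr_mult)
      finally have "?lhs \<le> D + c\<^sub>1 * \<gamma> powr \<kappa>"
        using error_le_measure_switching_set[OF lmeas d mono \<alpha> \<gamma> B bound K T[OF h] min
            assms(15)[OF \<gamma> h] \<delta>[OF \<gamma> h]]
        unfolding D_def by linarith
      also have "\<dots> \<le> 2 * D + (c\<^sub>1 + E / \<gamma>\<^sub>0 powr \<kappa>) * \<gamma> powr \<kappa>"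
        using D E' by (intro add_mono mult_right_mono) auto
      finally show ?thesis .
    next
      case False
      then have "E / \<gamma>\<^sub>0 powr \<kappa> * \<gamma>\<^sub>0 powr \<kappa> \<le> (c\<^sub>1 + E / \<gamma>\<^sub>0 powr \<kappa>) * \<gamma> powr \<kappa>"
        using \<gamma>0 \<kappa> c1 E' by (intro mult_mono powr_mono2) auto
      then have "E \<le> (c\<^sub>1 + E / \<gamma>\<^sub>0 powr \<kappa>) * \<gamma> powr \<kappa>" using \<gamma>0 by simp
      moreover have "?lhs \<le> 2 * D + E"
        unfolding D_def E_def using False \<gamma>0 bound C
        by (intro error_le_bounded[where T = "Kh h", OF lmeas _ K(1) _ ubar u[OF \<gamma> h] \<delta>(1)[OF \<gamma> h]]) auto
      ultimately show ?thesis by linarith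
    qed
    also have "\<dots> \<le> c * D + c * \<gamma> powr \<kappa>"
      unfolding c_def using D c1 E' by (intro add_mono mult_right_mono) auto
    finally show ?thesis unfolding D_def by (simp add: distrib_left)
  qed
  ultimately show ?thesis by blast
qed

end
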